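(* Let $p \ge 0$ and let $\underline{d}, \overline{d} \in \mathbb{Z}^{p+1}$ be strictly increasing sequences with $\underline{d}_i \leq \overline{d}_i$ for $0 \leq i \leq p$. Then the Boij-Söderberg poset $\Pi_{\underline{d}, \overline{d}}$ admits a recursive atom ordering when its atoms are ordered lexicographically from smallest to largest; that is, the list of the atoms in increasing lexicographic order is a recursive atom ordering of $\Pi_{\underline{d}, \overline{d}}$.
   Context: For strictly increasing sequences $\underline{d} = (\underline{d}_0,\dots,\underline{d}_p)$ and $\overline{d} = (\overline{d}_0,\dots,\overline{d}_p)$ in $\mathbb{Z}^{p+1}$ with $\underline{d}_i \leq \overline{d}_i$ for $0 \leq i \leq p$, the Boij-Söderberg poset $\Pi_{\underline{d},\overline{d}}$ is the set of strictly increasing sequences $d = (d_0,\dots,d_p) \in \mathbb{Z}^{p+1}$ such that $\underline{d}_i \leq d_i \leq \overline{d}_i$ for $0 \leq i \leq p$, with partial order $d \leq e$ if and only if $d_i \leq e_i$ for $0 \leq i \leq p$. Lexicographic order on sequences: $d$ is lexicographically smaller than $e$ if $d_i < e_i$ at the first index $i$ where $d$ and $e$ differ. For $x,y$ in a finite poset $P$, $y$ covers $x$, written $x \rightarrow y$, if $x<y$ and $x < z \leq y$ implies $z = y$. A poset is bounded if it has a unique minimal element $\hat{0}$ and a unique maximal element $\hat{1}$ (least and greatest elements); an atom of a bounded poset is an element covering $\hat{0}$. A poset is pure if all its maximal chains have the same length, where a chain $v_0<\cdots<v_q$ has length $q$. (The posets $\Pi_{\underline{d},\overline{d}}$ are known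 to be pure, and they are bounded by $\underline d$ and $\overline d$.) Recursive atom orderings (Björner-Wachs) of a finite bounded pure poset $P$ are defined recursively. If the maximal chains of $P$ have length at most one, then the (only) listing of the atoms of $P$ is a recursive atom ordering. Otherwise, an ordering $a_1,\dots,a_t$ of the atoms of $P$ is a recursive atom ordering if: (1) for $1 \leq j \leq t$, the interval $[a_j,\hat{1}]$ admits a recursive atom ordering $b_1,\dots,b_s$ of its atoms such that there exists $0 \leq k \leq s$ with the property that, for $1\le l\le s$, $a_i \rightarrow b_l$ for some $1 \leq i < j$ if and only if $l \leq k$; and (2) for $1 \leq i < j \leq t$, if $y\in P$ satisfies $a_i, a_j < y$, then there are a $k<j$ and a $z \in P$ such that $a_k \rightarrow z$, $a_j \rightarrow z$ and $z \leq y$. $P$ admits a recursive atom ordering if some ordering of its atoms is a recursive atom ordering. *)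

theory Defs
  imports Main "HOL-Library.List_Lexorder"
begin

text \<open>
  A poset is given by a carrier \<open>P\<close> and an order predicate \<open>le\<close>, of which only the restriction
  to \<open>P\<close> matters. A chain \<open>v\<^sub>0 < \<dots> < v\<^sub>q\<close>, viewed as a set \<open>C\<close>, has length \<open>q = card C - 1\<close>.
\<close>

definition poset_on :: "'a set \<Rightarrow> ('a \<Rightarrow> 'a \<Rightarrow> bool) \<Rightarrow> bool" where
  "poset_on P le \<longleftrightarrow> reflp_on P le \<and> antisymp_on P le \<and> transp_on P le"

definition least_in :: "'a set \<Rightarrow> ('a \<Rightarrow> 'a \<Rightarrow> bool) \<Rightarrow> 'a \<Rightarrow> bool" where
  "least_in P le b \<longleftrightarrow> b \<in> P \<and> (\<forall>x\<in>P. le b x)"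

definition greatest_in :: "'a set \<Rightarrow> ('a \<Rightarrow> 'a \<Rightarrow> bool) \<Rightarrow> 'a \<Rightarrow> bool" where
  "greatest_in P le t \<longleftrightarrow> t \<in> P \<and> (\<forall>x\<in>P. le x t)"

definition bot_of :: "'a set \<Rightarrow> ('a \<Rightarrow> 'a \<Rightarrow> bool) \<Rightarrow> 'a" where
  "bot_of P le = (THE b. least_in P le b)"

definition top_of :: "'a set \<Rightarrow> ('a \<Rightarrow> 'a \<Rightarrow> bool) \<Rightarrow> 'a" where
  "top_of P le = (THE t. greatest_in P le t)"

definition bounded_poset :: "'a set \<Rightarrow> ('a \<Rightarrow> 'a \<Rightarrow> bool) \<Rightarrow> bool" where
  "bounded_poset P le \<longleftrightarrow> (\<exists>b. least_in P le b) \<and> (\<exists>t. greatest_in P le t)"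

definition pure_poset :: "'a set \<Rightarrow> ('a \<Rightarrow> 'a \<Rightarrow> bool) \<Rightarrow> bool" where
  "pure_poset P le \<longleftrightarrow>
     (\<forall>C D. pred_on.maxchain P le C \<and> pred_on.maxchain P le D \<longrightarrow> card C - 1 = card D - 1)"

definition finite_bounded_pure_poset :: "'a set \<Rightarrow> ('a \<Rightarrow> 'a \<Rightarrow> bool) \<Rightarrow> bool" where
  "finite_bounded_pure_poset P le \<longleftrightarrow>
     finite P \<and> poset_on P le \<and> bounded_poset P le \<and> pure_poset P le"

text \<open>\<open>covers P le x y\<close> is \<open>x \<rightarrow> y\<close>, i.e. \<open>y\<close> covers \<open>x\<close>.\<close>

definition covers :: "'a set \<Rightarrow> ('a \<Rightarrow> 'a \<Rightarrow> bool) \<Rightarrow> 'a \<Rightarrow> 'a \<Rightarrow> bool" where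
  "covers P le x y \<longleftrightarrow> x \<in> P \<and> y \<in> P \<and> le x y \<and> x \<noteq> y \<and>
     (\<forall>z\<in>P. le x z \<and> x \<noteq> z \<and> le z y \<longrightarrow> z = y)"

definition atoms_of :: "'a set \<Rightarrow> ('a \<Rightarrow> 'a \<Rightarrow> bool) \<Rightarrow> 'a set" where
  "atoms_of P le = {a. covers P le (bot_of P le) a}"

definition interval_in :: "'a set \<Rightarrow> ('a \<Rightarrow> 'a \<Rightarrow> bool) \<Rightarrow> 'a \<Rightarrow> 'a \<Rightarrow> 'a set" where
  "interval_in P le x y = {z\<in>P. le x z \<and> le z y}"

text \<open>
  Lists are indexed from 0, so the condition \<open>l \<le> k\<close> on 1-based indices becomes \<open>l < k\<close>.
\<close>

inductive recursive_atom_ordering :: "('a \<Rightarrow> 'a \<Rightarrow> bool) \<Rightarrow> 'a set \<Rightarrow> 'a list \<Rightarrow> bool"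
  for le :: "'a \<Rightarrow> 'a \<Rightarrow> bool" where
  short:
    "recursive_atom_ordering le P as"
    if "finite_bounded_pure_poset P le"
      and "distinct as" and "set as = atoms_of P le"
      and "\<forall>C. pred_on.maxchain P le C \<longrightarrow> card C - 1 \<le> 1"
| long:
    "recursive_atom_ordering le P as"
    if "finite_bounded_pure_poset P le"
      and "distinct as" and "set as = atoms_of P le"
      and "\<not> (\<forall>C. pred_on.maxchain P le C \<longrightarrow> card C - 1 \<le> 1)"
      and "\<forall>j<length as. \<exists>bs.
             recursive_atom_ordering le (interval_in P le (as ! j) (top_of P le)) bs \<and>
             (\<exists>k\<le>length bs. \<forall>l<length bs.
                (\<exists>i<j. covers P le (as ! i) (bs ! l)) \<longleftrightarrow> l < k)"
      and "\<forall>j<length as. \<forall>i<j. \<forall>y\<in>P.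
             le (as ! i) y \<and> as ! i \<noteq> y \<and> le (as ! j) y \<and> as ! j \<noteq> y \<longrightarrow>
             (\<exists>k<j. \<exists>z\<in>P. covers P le (as ! k) z \<and> covers P le (as ! j) z \<and> le z y)"

text \<open>
  A sequence in \<open>\<int>\<^bsup>p+1\<^esup>\<close> is an integer list of length \<open>p + 1\<close>. The poset order is the
  componentwise one; the order \<open>\<le>\<close> of the type \<^typ>\<open>int list\<close> is the lexicographic order.
\<close>

definition componentwise_le :: "int list \<Rightarrow> int list \<Rightarrow> bool" where
  "componentwise_le d e \<longleftrightarrow> list_all2 (\<le>) d e"

definition boij_soederberg_poset :: "int list \<Rightarrow> int list \<Rightarrow> int list set" where
  "boij_soederberg_poset dl du =
     {d. sorted_wrt (<) d \<and> componentwise_le dl d \<and> componentwise_le d du}"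

end

theory Submission
  imports Defs
begin

text \<open>
  The covers of \<open>d\<close> are the sequences obtained by adding 1 to a single entry, so raising
  entry \<open>i\<close> gives a lexicographically smaller atom the larger \<open>i\<close> is, and the entry sum is a rank
  function. Raising entry \<open>m\<close> of \<open>d\<close> does not affect whether an entry \<open>n > m\<close> can be raised;
  hence an atom \<open>d + e\<^sub>m + e\<^sub>n\<close> of \<open>[d + e\<^sub>m, 1]\<close> covers a lexicographically earlier atom of the
  whole poset iff \<open>n > m\<close>, and these come first in the lexicographic order.
  Two atoms \<open>d + e\<^sub>m\<close>, \<open>d + e\<^sub>n\<close> always have the join \<open>d + e\<^sub>m + e\<^sub>n\<close>, which covers both.
\<close>

subsection \<open>The componentwise order\<close>

lemma componentwise_le_refl [simp]: "componentwise_le x x"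
  by (simp add: componentwise_le_def list_all2_refl)

text \<open>The library notion of chain uses the reflexive closure of the relation, which changes
  nothing here because the order is already reflexive.\<close>

lemma chain_componentwise_le_iff:
  "pred_on.chain P componentwise_le C \<longleftrightarrow>
     C \<subseteq> P \<and> (\<forall>x\<in>C. \<forall>y\<in>C. componentwise_le x y \<or> componentwise_le y x)"
proof -
  have "componentwise_le\<^sup>=\<^sup>= = componentwise_le" by (auto simp: fun_eq_iff)
  then show ?thesis by (simp add: pred_on.chain_def)
qed

lemma componentwise_le_trans:
  "componentwise_le x y \<Longrightarrow> componentwise_le y z \<Longrightarrow> componentwise_le x z"
  unfolding componentwise_le_def by (rule list_all2_trans) auto

lemma componentwise_le_antisym:
  "componentwise_le x y \<Longrightarrow> componentwise_le y x \<Longrightarrow> x = y"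
  unfolding componentwise_le_def by (rule list_all2_antisym) auto

lemma componentwise_le_iff_nth:
  "componentwise_le x y \<longleftrightarrow> length x = length y \<and> (\<forall>i<length x. x ! i \<le> y ! i)"
  by (simp add: componentwise_le_def list_all2_conv_all_nth)

lemma sum_list_mono_componentwise:
  "componentwise_le x y \<Longrightarrow> sum_list x \<le> sum_list y"
  unfolding componentwise_le_def by (induction rule: list_all2_induct) auto

text \<open>Makes the entry sum usable as a rank function: comparable sequences with equal sums
  coincide.\<close>

lemma sum_list_strict_mono_componentwise:
  assumes "componentwise_le x y" "x \<noteq> y"
  shows "sum_list x < sum_list y"
proof -
  have "list_all2 (\<le>) x y \<Longrightarrow> x \<noteq> y \<longrightarrow> sum_list x < sum_list y"
  proof (induction rule: list_all2_induct)
    case (Cons a x b y)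
    then show ?case
      using sum_list_mono_componentwise[of x y] by (fastforce simp: componentwise_le_def)
  qed simp
  with assms show ?thesis by (simp add: componentwise_le_def)
qed

subsection \<open>Raising one entry\<close>

text \<open>For an index out of range the list update does nothing, so \<open>raise d i\<close> is
  then \<open>d\<close> itself; facts such as \<open>raise_commute\<close> therefore hold for all
  indices.\<close>

definition raise :: "int list \<Rightarrow> nat \<Rightarrow> int list" where
  "raise d i = d[i := d ! i + 1]"

lemma length_raise [simp]: "length (raise d i) = length d"
  by (simp add: raise_def)

lemma nth_raise: "k < length d \<Longrightarrow> raise d i ! k = d ! k + (if k = i then 1 else 0)"
  by (auto simp: raise_def nth_list_update)

lemma raise_commute: "raise (raise d i) j = raise (raise d j) i"
  by (rule nth_equalityI) (auto simp: nth_raise)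

lemma sum_list_raise: "i < length d \<Longrightarrow> sum_list (raise d i) = sum_list d + 1"
proof (induction d arbitrary: i)
  case (Cons a d)
  then show ?case by (cases i) (auto simp: raise_def)
qed simp

lemma raise_neq: "i < length d \<Longrightarrow> raise d i \<noteq> d"
  using sum_list_raise[of i d] by auto

lemma componentwise_le_raise: "componentwise_le d (raise d i)"
  by (auto simp: componentwise_le_iff_nth nth_raise)

text \<open>The two lists first differ at the smaller of the two indices, and the one raised there
  is the larger. Trichotomy gives the equivalence.\<close>

lemma raise_less_iff:
  assumes "i < length d" "j < length d"
  shows "raise d i < raise d j \<longleftrightarrow> j < i"
proof -
  have less: "raise d i < raise d j" if "j < i" "i < length d" for i j
  proof -
    have "take j (raise d i) = take j (raise d j)"
      using that by (simp add: raise_def)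
    moreover have "raise d i ! j < raise d j ! j"
      using that by (simp add: nth_raise)
    ultimately show ?thesis
      using that unfolding list_less_def lexord_take_index_conv by (auto intro!: exI[of _ j])
  qed
  show ?thesis
    using less[of i j] less[of j i] assms by (metis linorder_neqE_nat order_less_asym order_less_irrefl)
qed

lemma strict_sorted_iff_nth_Suc:
  "sorted_wrt (<) (d :: int list) \<longleftrightarrow> (\<forall>i. Suc i < length d \<longrightarrow> d ! i < d ! Suc i)"
  by (rule sorted_wrt_iff_nth_Suc_transp) simp

text \<open>Raising entry \<open>i\<close> only widens the gap to its predecessor, so the comparison
  with its successor is the only one at risk.\<close>

lemma strict_sorted_raise_iff:
  assumes "sorted_wrt (<) d" "i < length d"
  shows "sorted_wrt (<) (raise d i) \<longleftrightarrow> (Suc i < length d \<longrightarrow> d ! i + 1 < d ! Suc i)"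
  using assms unfolding strict_sorted_iff_nth_Suc
  by (force simp: nth_raise)

text \<open>Whether entry \<open>n\<close> can be raised depends on entries \<open>n\<close> and
  \<open>Suc n\<close> alone, and neither is entry \<open>m\<close>.\<close>

lemma strict_sorted_raise_raise_iff:
  assumes "sorted_wrt (<) d" "sorted_wrt (<) (raise d m)" "m < n" "n < length d"
  shows "sorted_wrt (<) (raise (raise d m) n) \<longleftrightarrow> sorted_wrt (<) (raise d n)"
  using assms strict_sorted_raise_iff[of "raise d m" n] strict_sorted_raise_iff[of d n]
  by (simp add: nth_raise)

text \<open>The last entry where \<open>x\<close> and \<open>y\<close> differ can be raised without violating strictness.\<close>

lemma exists_raise_between:
  assumes "sorted_wrt (<) x" "sorted_wrt (<) y" "componentwise_le x y" "x \<noteq> y"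
  obtains i where "i < length x" "sorted_wrt (<) (raise x i)" "componentwise_le (raise x i) y"
proof -
  define D where "D = {i. i < length x \<and> x ! i < y ! i}"
  have len: "length y = length x" and le: "\<And>i. i < length x \<Longrightarrow> x ! i \<le> y ! i"
    using assms(3) by (auto simp: componentwise_le_iff_nth)
  have "finite D" by (simp add: D_def)
  have "D \<noteq> {}"
  proof
    assume "D = {}"
    with le have "x ! i = y ! i" if "i < length x" for i
      using that by (force simp: D_def)
    with len have "x = y" by (simp add: nth_equalityI)
    with assms(4) show False ..
  qed
  define i where "i = Max D"
  have i: "i < length x" "x ! i < y ! i"
    using Max_in[OF \<open>finite D\<close> \<open>D \<noteq> {}\<close>] by (auto simp: i_def D_def)
  \<comment> \<open>By maximality of \<open>i\<close>, \<open>x\<close> and \<open>y\<close> agree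
    at \<open>Suc i\<close>, so strictness of \<open>y\<close> gives x_i + 1 \<le> y_i < y_{i+1} =
    x_{i+1}.\<close>
  have "x ! i + 1 < x ! Suc i" if "Suc i < length x"
  proof -
    have "Suc i \<notin> D" using Max_ge[OF \<open>finite D\<close>, of "Suc i"] by (auto simp: i_def)
    with that le[of "Suc i"] have "x ! Suc i = y ! Suc i" by (simp add: D_def)
    moreover have "y ! i < y ! Suc i"
      using assms(2) that len by (simp add: strict_sorted_iff_nth_Suc)
    ultimately show ?thesis using i by simp
  qed
  then have "sorted_wrt (<) (raise x i)"
    using assms(1) i by (simp add: strict_sorted_raise_iff)
  moreover have "componentwise_le (raise x i) y"
    using i le len by (auto simp: componentwise_le_iff_nth nth_raise)
  ultimately show ?thesis using i that by blast
qed

text \<open>As \<open>m\<close> and \<open>n\<close> differ, no entry rises by more than 1, so each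
  entry is bounded by one of the two assumptions.\<close>

lemma componentwise_le_raise_raise:
  assumes "componentwise_le (raise d m) y" "componentwise_le (raise d n) y" "m \<noteq> n"
  shows "componentwise_le (raise (raise d m) n) y"
  using assms by (auto simp: componentwise_le_iff_nth nth_raise split: if_splits)

subsection \<open>Boij-Soederberg posets\<close>

lemma boij_soederberg_poset_iff:
  "x \<in> boij_soederberg_poset dl du \<longleftrightarrow>
     sorted_wrt (<) x \<and> componentwise_le dl x \<and> componentwise_le x du"
  by (simp add: boij_soederberg_poset_def)

lemma finite_boij_soederberg_poset: "finite (boij_soederberg_poset dl du)"
proof (rule finite_subset)
  let ?S = "\<Union>i<length dl. {dl ! i..du ! i}"
  show "boij_soederberg_poset dl du \<subseteq> {xs. set xs \<subseteq> ?S \<and> length xs = length dl}"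
    by (fastforce simp: boij_soederberg_poset_iff componentwise_le_iff_nth in_set_conv_nth)
  show "finite {xs. set xs \<subseteq> ?S \<and> length xs = length dl}"
    by (rule finite_lists_length_eq) simp
qed

lemma poset_on_componentwise_le: "poset_on P componentwise_le"
  unfolding poset_on_def reflp_on_def antisymp_on_def transp_on_def
  using componentwise_le_antisym componentwise_le_trans by auto

text \<open>Some raise of \<open>x\<close> always fits below \<open>y\<close>, so a cover must equal
  it. Conversely a raise adds 1 to the entry sum, and no integer lies strictly between for an
  intermediate element.\<close>

lemma covers_boij_soederberg_iff:
  assumes "x \<in> boij_soederberg_poset dl du"
  shows "covers (boij_soederberg_poset dl du) componentwise_le x y \<longleftrightarrow>
    (\<exists>i<length x. y = raise x i \<and> y \<in> boij_soederberg_poset dl du)" (is "covers ?P _ _ _ \<longleftrightarrow> ?R")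
proof
  assume cov: "covers ?P componentwise_le x y"
  then have y: "y \<in> ?P" "componentwise_le x y" "x \<noteq> y" by (auto simp: covers_def)
  with assms obtain i where i: "i < length x" "sorted_wrt (<) (raise x i)"
      "componentwise_le (raise x i) y"
    using exists_raise_between[of x y] by (auto simp: boij_soederberg_poset_iff)
  have "raise x i \<in> ?P"
    using i y assms componentwise_le_raise componentwise_le_trans
    unfolding boij_soederberg_poset_iff by blast
  then have "raise x i = y"
    using cov i raise_neq[of i x] componentwise_le_raise[of x i] unfolding covers_def by metis
  with i y show ?R by blast
next
  assume ?R
  then obtain i where i: "i < length x" "y = raise x i" "y \<in> ?P" by blast
  have "z = y" if "componentwise_le x z" "x \<noteq> z" "componentwise_le z y" for z
  proof (rule ccontr)
    assume "z \<noteq> y"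
    then have "sum_list x < sum_list z" "sum_list z < sum_list y"
      using that sum_list_strict_mono_componentwise by blast+
    then show False using i by (simp add: sum_list_raise)
  qed
  then show "covers ?P componentwise_le x y"
    using i assms raise_neq[of i x] componentwise_le_raise[of x i] unfolding covers_def by auto
qed

lemma covers_raise:
  assumes "x \<in> boij_soederberg_poset dl du" "raise x i \<in> boij_soederberg_poset dl du"
    and "i < length x"
  shows "covers (boij_soederberg_poset dl du) componentwise_le x (raise x i)"
  using assms covers_boij_soederberg_iff by blast

section \<open>Bounds, upper intervals and purity\<close>

locale boij_soederberg_bounds =
  fixes dl du :: "int list"
  assumes sorted_dl: "sorted_wrt (<) dl"
    and sorted_du: "sorted_wrt (<) du"
    and dl_le_du: "componentwise_le dl du"
begin

abbreviation "P \<equiv> boij_soederberg_poset dl du"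

lemma dl_in [simp]: "dl \<in> P" and du_in [simp]: "du \<in> P"
  using sorted_dl sorted_du dl_le_du by (auto simp: boij_soederberg_poset_iff)

lemma least_dl: "least_in P componentwise_le dl"
  by (auto simp: least_in_def) (simp add: boij_soederberg_poset_iff)

lemma greatest_du: "greatest_in P componentwise_le du"
  by (auto simp: greatest_in_def) (simp add: boij_soederberg_poset_iff)

lemma bot_of_eq: "bot_of P componentwise_le = dl"
  unfolding bot_of_def
  using least_dl by (rule the_equality)
    (use least_dl in \<open>auto simp: least_in_def intro: componentwise_le_antisym\<close>)

lemma top_of_eq: "top_of P componentwise_le = du"
  unfolding top_of_def
  using greatest_du by (rule the_equality)
    (use greatest_du in \<open>auto simp: greatest_in_def intro: componentwise_le_antisym\<close>)

text \<open>Keeps the recursion inside the family: an upper interval is again a Boij-Soederberg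
  poset, with new lower bound \<open>a\<close> and the same \<open>du\<close>.\<close>

lemma interval_to_top:
  assumes "a \<in> P"
  shows "interval_in P componentwise_le a du = boij_soederberg_poset a du"
  using assms unfolding interval_in_def boij_soederberg_poset_def
  by (auto intro: componentwise_le_trans[of dl a])

lemma atoms_of_eq: "atoms_of P componentwise_le = {raise dl i |i. i < length dl \<and> raise dl i \<in> P}"
  unfolding atoms_of_def bot_of_eq covers_boij_soederberg_iff[OF dl_in] by auto

lemma finite_atoms: "finite (atoms_of P componentwise_le)"
  by (rule finite_subset[OF _ finite_boij_soederberg_poset[of dl du]]) (auto simp: atoms_of_eq)

text \<open>A maximal chain has exactly one element of each entry sum between those of \<open>dl\<close> and \<open>du\<close>.\<close>

lemma card_maxchain:
  assumes "pred_on.maxchain P componentwise_le C"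
  shows "card C = card {sum_list dl..sum_list du}"
proof -
  have chain: "pred_on.chain P componentwise_le C"
    and no_larger: "\<And>S. pred_on.chain P componentwise_le S \<Longrightarrow> \<not> C \<subset> S"
    using assms unfolding pred_on.maxchain_def by blast+
  from chain have sub: "C \<subseteq> P"
    and lin: "\<And>x y. x \<in> C \<Longrightarrow> y \<in> C \<Longrightarrow> componentwise_le x y \<or> componentwise_le y x"
    unfolding chain_componentwise_le_iff by blast+
  \<comment> \<open>Maximality in the form used below: whatever is comparable to all of
    \<open>C\<close> already lies in \<open>C\<close>.\<close>
  have max: "z \<in> C"
    if z: "z \<in> P" "\<And>x. x \<in> C \<Longrightarrow> componentwise_le x z \<or> componentwise_le z x" for z
  proof (rule ccontr)
    assume "z \<notin> C"
    moreover have "pred_on.chain P componentwise_le (insert z C)"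
      unfolding chain_componentwise_le_iff ball_simps
      using sub lin z componentwise_le_refl by blast
    ultimately show False using no_larger by blast
  qed
  have finC: "finite C" using finite_subset[OF sub finite_boij_soederberg_poset] .
  have bounds: "componentwise_le dl x" "componentwise_le x du" if "x \<in> C" for x
    using subsetD[OF sub that] by (simp_all add: boij_soederberg_poset_iff)
  have dlC: "dl \<in> C" by (rule max) (simp_all add: bounds)
  have duC: "du \<in> C" by (rule max) (simp_all add: bounds)
  \<comment> \<open>Let \<open>y\<close> be the next element of the chain above \<open>x\<close>,
    found by minimizing the entry sum. A raise of \<open>x\<close> below \<open>y\<close> is
    comparable to the whole chain, hence belongs to it.\<close>
  have step: "\<exists>y\<in>C. sum_list y = sum_list x + 1" if x: "x \<in> C" "x \<noteq> du" for x
  proof -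
    let ?U = "{y\<in>C. componentwise_le x y \<and> x \<noteq> y}"
    have "?U \<noteq> {}" "finite ?U" using x duC finC bounds by auto
    then obtain y where y: "y \<in> ?U" "\<And>z. z \<in> ?U \<Longrightarrow> sum_list y \<le> sum_list z"
      using arg_min_if_finite(1)[of ?U sum_list] arg_min_least[of ?U _ sum_list] by blast
    have xyP: "x \<in> P" "y \<in> P" using x y sub by auto
    then obtain i where i: "i < length x" "sorted_wrt (<) (raise x i)"
        "componentwise_le (raise x i) y"
      using y exists_raise_between[of x y] by (auto simp: boij_soederberg_poset_iff)
    have "raise x i \<in> C"
    proof (rule max)
      show "raise x i \<in> P"
        using i xyP componentwise_le_raise componentwise_le_trans
        unfolding boij_soederberg_poset_iff by blast
      fix w assume w: "w \<in> C"
      show "componentwise_le w (raise x i) \<or> componentwise_le (raise x i) w"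
      proof (cases "componentwise_le w x")
        case True
        then show ?thesis using componentwise_le_raise componentwise_le_trans by blast
      next
        case False
        then have "w \<in> ?U" using lin w x by auto
        then have "sum_list y \<le> sum_list w" by (rule y)
        \<comment> \<open>Both lie in the chain, and \<open>w\<close> strictly below
          \<open>y\<close> would have a smaller entry sum.\<close>
        then have "componentwise_le y w"
          using lin[of y w] y w sum_list_strict_mono_componentwise[of w y] by force
        then show ?thesis using i componentwise_le_trans by blast
      qed
    qed
    then show ?thesis using i sum_list_raise by blast
  qed
  have surj: "\<exists>x\<in>C. sum_list x = sum_list dl + int n" if "sum_list dl + int n \<le> sum_list du" for n
    using that
  proof (induction n)
    case 0
    then show ?case using dlC by auto
  next
    case (Suc n)
    then obtain x where "x \<in> C" "sum_list x = sum_list dl + int n" by auto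
    with Suc.prems step[of x] show ?case by force
  qed
  have "sum_list ` C = {sum_list dl..sum_list du}"
  proof
    show "sum_list ` C \<subseteq> {sum_list dl..sum_list du}"
      using bounds sum_list_mono_componentwise by auto
    show "{sum_list dl..sum_list du} \<subseteq> sum_list ` C"
    proof
      fix s assume "s \<in> {sum_list dl..sum_list du}"
      then show "s \<in> sum_list ` C" using surj[of "nat (s - sum_list dl)"] by force
    qed
  qed
  moreover have "inj_on sum_list C"
  proof (rule inj_onI, rule ccontr)
    fix x y assume "x \<in> C" "y \<in> C" "sum_list x = sum_list y" "x \<noteq> y"
    then show False
      using lin[of x y] sum_list_strict_mono_componentwise[of x y]
        sum_list_strict_mono_componentwise[of y x] by auto
  qed
  ultimately show ?thesis by (metis card_image)
qed

lemma finite_bounded_pure: "finite_bounded_pure_poset P componentwise_le"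
  unfolding finite_bounded_pure_poset_def bounded_poset_def pure_poset_def
  using finite_boij_soederberg_poset poset_on_componentwise_le least_dl greatest_du card_maxchain
  by auto

section \<open>Atoms and their common covers\<close>

lemma raise_in_poset_iff:
  assumes "x \<in> P"
  shows "raise x n \<in> P \<longleftrightarrow> sorted_wrt (<) (raise x n) \<and> componentwise_le (raise x n) du"
  using assms componentwise_le_trans[OF _ componentwise_le_raise, of dl x n]
  by (auto simp: boij_soederberg_poset_iff)

text \<open>Supplies the common cover of two atoms. Strictness survives because the larger index is
  raised second, and the upper bound \<open>du\<close> is inherited from the two single
  raises.\<close>

lemma raise_raise_in_poset:
  assumes "m < n" "n < length dl" "raise dl m \<in> P" "raise dl n \<in> P"
  shows "raise (raise dl m) n \<in> P"
  using assms sorted_dl strict_sorted_raise_raise_iff[of dl m n] raise_in_poset_iff[of "raise dl m" n]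
    componentwise_le_raise_raise[of dl m du n]
  by (auto simp: boij_soederberg_poset_iff)

text \<open>The order of the indices matters: if \<open>n + 1 = m\<close>, raising entry
  \<open>m\<close> may be what makes room for raising entry \<open>n\<close>.\<close>

lemma raise_in_poset_if_raise_raise:
  assumes "m < n" "n < length dl" "raise dl m \<in> P" "raise (raise dl m) n \<in> P"
  shows "raise dl n \<in> P"
proof -
  have "componentwise_le (raise dl n) du"
    using assms(4) componentwise_le_raise[of "raise dl n" m]
      componentwise_le_trans[of "raise dl n" "raise (raise dl n) m" du]
    by (auto simp: boij_soederberg_poset_iff raise_commute[of dl m n])
  then show ?thesis
    using assms sorted_dl strict_sorted_raise_raise_iff[of dl m n] raise_in_poset_iff[of dl n]
    by (auto simp: componentwise_le_raise boij_soederberg_poset_iff)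
qed

text \<open>The only atoms that the double raise can cover are the raises at \<open>m\<close> and at
  \<open>n\<close>, and the one at \<open>n\<close> comes earlier exactly when
  \<open>m < n\<close>.\<close>

lemma covers_earlier_atom_iff:
  assumes "m < length dl" "raise dl m \<in> P" "n < length dl" "raise (raise dl m) n \<in> P"
  shows "(\<exists>x\<in>atoms_of P componentwise_le. x < raise dl m \<and>
           covers P componentwise_le x (raise (raise dl m) n)) \<longleftrightarrow> m < n" (is "?L \<longleftrightarrow> _")
proof
  assume ?L
  then obtain q where q: "q < length dl" "raise dl q \<in> P" "raise dl q < raise dl m"
      and "covers P componentwise_le (raise dl q) (raise (raise dl m) n)"
    unfolding atoms_of_eq by blast
  then obtain r where r: "raise (raise dl m) n = raise (raise dl q) r"
    using covers_boij_soederberg_iff by blast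
  have "m < q" using q assms raise_less_iff[of q dl m] by simp
  \<comment> \<open>Entry \<open>q\<close> has grown on the right-hand side of \<open>r\<close>;
    since \<open>q\<close> is not \<open>m\<close>, only the raise at \<open>n\<close> can account
    for this on the left.\<close>
  moreover have "q = n"
    using arg_cong[OF r, of "\<lambda>x. x ! q"] q \<open>m < q\<close> by (auto simp: nth_raise split: if_splits)
  ultimately show "m < n" by simp
next
  assume "m < n"
  then have n: "raise dl n \<in> P" using assms raise_in_poset_if_raise_raise by blast
  moreover have "covers P componentwise_le (raise dl n) (raise (raise dl m) n)"
    using covers_raise[of "raise dl n" dl du m] assms n by (simp add: raise_commute[of dl m n])
  moreover have "raise dl n < raise dl m" using assms \<open>m < n\<close> by (simp add: raise_less_iff)
  ultimately show ?L using assms unfolding atoms_of_eq by blast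
qed

end

subsection \<open>The recursive atom ordering\<close>

text \<open>Trades positions in the sorted list for the order of its elements, so that list indices
  disappear from the first condition on orderings.\<close>

lemma ex_nth_earlier_sorted_list_of_set_iff:
  fixes A :: "'a::linorder set"
  assumes "finite A" "j < card A"
  shows "(\<exists>i<j. Q (sorted_list_of_set A ! i)) \<longleftrightarrow> (\<exists>x\<in>A. x < sorted_list_of_set A ! j \<and> Q x)"
    (is "?L \<longleftrightarrow> ?R")
proof -
  let ?xs = "sorted_list_of_set A"
  have less: "?xs ! i < ?xs ! k" if "i < k" "k < card A" for i k
    using sorted_wrt_nth_less[OF strict_sorted_list_of_set] that by simp
  show ?thesis
  proof
    assume ?L
    then obtain i where i: "i < j" "Q (?xs ! i)" by blast
    moreover have "?xs ! i \<in> A" using nth_mem[of i ?xs] i assms by simp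
    ultimately show ?R using less assms by blast
  next
    assume ?R
    then obtain x where x: "x \<in> A" "x < ?xs ! j" "Q x" by blast
    with assms obtain i where i: "i < card A" "?xs ! i = x"
      using in_set_conv_nth[of x ?xs] by auto
    then have "i < j" using less[of j i] x by (cases i j rule: linorder_cases) auto
    with i x show ?L by blast
  qed
qed

text \<open>Yields the threshold \<open>k\<close> of the first condition: a property inherited by
  smaller indices holds on an initial segment.\<close>

lemma downward_closed_prefix:
  assumes "\<And>l m. l < m \<Longrightarrow> m < N \<Longrightarrow> Q m \<Longrightarrow> Q l"
  shows "\<exists>k\<le>N::nat. \<forall>l<N. Q l \<longleftrightarrow> l < k"
  using assms
proof (induction N)
  case (Suc N)
  then obtain k where k: "k \<le> N" "\<forall>l<N. Q l \<longleftrightarrow> l < k"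
    by (meson less_Suc_eq)
  show ?case
  proof (cases "Q N")
    case True
    then have "\<forall>l<Suc N. Q l" using Suc.prems less_Suc_eq by blast
    then show ?thesis by blast
  next
    case False
    then show ?thesis using k by (intro exI[of _ k]) (auto simp: less_Suc_eq)
  qed
qed simp

text \<open>Induction on the rank, with \<open>du\<close> fixed and \<open>dl\<close> varying:
  passing from \<open>dl\<close> to an atom lowers the difference of the entry sums by 1.\<close>

lemma recursive_atom_ordering_boij_soederberg:
  assumes "boij_soederberg_bounds dl du"
  shows "recursive_atom_ordering componentwise_le (boij_soederberg_poset dl du)
           (sorted_list_of_set (atoms_of (boij_soederberg_poset dl du) componentwise_le))"
  using assms
proof (induction "nat (sum_list du - sum_list dl)" arbitrary: dl rule: less_induct)
  case less
  interpret boij_soederberg_bounds dl du by (rule less.prems)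
  let ?le = componentwise_le
  let ?A = "atoms_of P ?le"
  let ?as = "sorted_list_of_set ?A"
  have len: "length ?as = card ?A" by simp
  have nth_atom: "\<exists>m<length dl. ?as ! j = raise dl m \<and> raise dl m \<in> P" if "j < card ?A" for j
    using that nth_mem[of j ?as] finite_atoms by (auto simp: atoms_of_eq)
  show ?case
  proof (cases "\<forall>C. pred_on.maxchain P ?le C \<longrightarrow> card C - 1 \<le> 1")
    case True
    then show ?thesis
      using finite_bounded_pure finite_atoms by (intro recursive_atom_ordering.short) auto
  next
    case False
    show ?thesis
    proof (rule recursive_atom_ordering.long)
      show "\<forall>j<length ?as. \<exists>bs.
             recursive_atom_ordering ?le (interval_in P ?le (?as ! j) (top_of P ?le)) bs \<and>
             (\<exists>k\<le>length bs. \<forall>l<length bs. (\<exists>i<j. covers P ?le (?as ! i) (bs ! l)) \<longleftrightarrow> l < k)"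
        unfolding len
      proof (intro allI impI)
        fix j assume j: "j < card ?A"
        then obtain m where m: "m < length dl" "?as ! j = raise dl m" "raise dl m \<in> P"
          using nth_atom by blast
        define a where "a = raise dl m"
        interpret a: boij_soederberg_bounds a du
          using m sorted_du by unfold_locales (auto simp: a_def boij_soederberg_poset_iff)
        let ?B = "atoms_of a.P ?le"
        let ?bs = "sorted_list_of_set ?B"
        have aP: "a \<in> P" and len_a: "length a = length dl" using m by (auto simp: a_def)
        have sub: "a.P \<subseteq> P" using interval_to_top[OF aP] by (auto simp: interval_in_def)
        have "nat (sum_list du - sum_list a) < nat (sum_list du - sum_list dl)"
          using sum_list_raise[OF m(1)] sum_list_mono_componentwise[OF a.dl_le_du]
          by (simp add: a_def)
        then have rec: "recursive_atom_ordering ?le a.P ?bs"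
          using less.hyps a.boij_soederberg_bounds_axioms by blast
        have nth_b: "\<exists>n<length dl. ?bs ! l = raise a n \<and> raise a n \<in> P" if "l < card ?B" for l
          using that nth_mem[of l ?bs] a.finite_atoms sub len_a by (auto simp: a.atoms_of_eq)
        \<comment> \<open>The first condition becomes a comparison of raised indices. Covering is
          tested in \<open>P\<close>, which contains the interval poset \<open>a.P\<close>.\<close>
        have earlier: "(\<exists>i<j. covers P ?le (?as ! i) (raise a n)) \<longleftrightarrow> m < n"
          if "n < length dl" "raise a n \<in> P" for n
          using ex_nth_earlier_sorted_list_of_set_iff[OF finite_atoms j,
              of "\<lambda>x. covers P ?le x (raise a n)"]
            covers_earlier_atom_iff[OF m(1,3), of n] that m(2) by (simp add: a_def)
        have "\<exists>k\<le>card ?B. \<forall>l<card ?B. (\<exists>i<j. covers P ?le (?as ! i) (?bs ! l)) \<longleftrightarrow> l < k"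
        proof (rule downward_closed_prefix)
          fix l r assume lr: "l < r" "r < card ?B"
            and r: "\<exists>i<j. covers P ?le (?as ! i) (?bs ! r)"
          obtain s where s: "s < length dl" "?bs ! r = raise a s" "raise a s \<in> P"
            using nth_b lr by blast
          obtain t where t: "t < length dl" "?bs ! l = raise a t" "raise a t \<in> P"
            using nth_b lr by (meson order.strict_trans)
          have "?bs ! l < ?bs ! r"
            using sorted_wrt_nth_less[OF strict_sorted_list_of_set] lr by simp
          \<comment> \<open>An earlier atom of the interval has a larger raised index, so
            \<open>m < s\<close> passes on to \<open>m < t\<close>.\<close>
          then have "s < t" using s t len_a raise_less_iff by metis
          moreover have "m < s"
            using r earlier[OF s(1,3)] s(2) by simp
          ultimately show "\<exists>i<j. covers P ?le (?as ! i) (?bs ! l)"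
            using earlier[OF t(1,3)] t(2) by simp
        qed
        then show "\<exists>bs. recursive_atom_ordering ?le (interval_in P ?le (?as ! j) (top_of P ?le)) bs \<and>
             (\<exists>k\<le>length bs. \<forall>l<length bs. (\<exists>i<j. covers P ?le (?as ! i) (bs ! l)) \<longleftrightarrow> l < k)"
          using rec interval_to_top[OF aP] m
          by (intro exI[of _ ?bs]) (simp add: top_of_eq a_def)
      qed
      show "\<forall>j<length ?as. \<forall>i<j. \<forall>y\<in>P.
             ?le (?as ! i) y \<and> ?as ! i \<noteq> y \<and> ?le (?as ! j) y \<and> ?as ! j \<noteq> y \<longrightarrow>
             (\<exists>k<j. \<exists>z\<in>P. covers P ?le (?as ! k) z \<and> covers P ?le (?as ! j) z \<and> ?le z y)"
        unfolding len
      proof (intro allI impI ballI)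
        fix i j y
        assume j: "j < card ?A" and ij: "i < j"
          and y: "?le (?as ! i) y \<and> ?as ! i \<noteq> y \<and> ?le (?as ! j) y \<and> ?as ! j \<noteq> y"
        obtain m where m: "m < length dl" "?as ! j = raise dl m" "raise dl m \<in> P"
          using nth_atom j by blast
        obtain n where n: "n < length dl" "?as ! i = raise dl n" "raise dl n \<in> P"
          using nth_atom ij j by (meson order.strict_trans)
        have "?as ! i < ?as ! j"
          using sorted_wrt_nth_less[OF strict_sorted_list_of_set] ij j by simp
        then have "m < n" using m n raise_less_iff by metis
        \<comment> \<open>The second condition holds with the index \<open>i\<close> itself as
          \<open>k\<close>, since the join \<open>?z\<close> covers both atoms.\<close>
        let ?z = "raise (raise dl m) n"
        have z: "?z \<in> P" using raise_raise_in_poset \<open>m < n\<close> m n by blast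
        moreover have "covers P ?le (raise dl m) ?z"
          using covers_raise z m n by simp
        moreover have "covers P ?le (raise dl n) ?z"
          using covers_raise[of "raise dl n" dl du m] z m n by (simp add: raise_commute[of dl m n])
        moreover have "?le ?z y"
          using y m n \<open>m < n\<close> componentwise_le_raise_raise by auto
        ultimately show "\<exists>k<j. \<exists>z\<in>P. covers P ?le (?as ! k) z \<and> covers P ?le (?as ! j) z \<and> ?le z y"
          using ij m n by metis
      qed
    qed (use False finite_bounded_pure finite_atoms in auto)
  qed
qed

theorem theorem3p1:
  fixes p :: nat and dl du :: "int list"
  assumes "length dl = p + 1" and "length du = p + 1"
    and "sorted_wrt (<) dl" and "sorted_wrt (<) du"
    and "\<forall>i\<le>p. dl ! i \<le> du ! i"
  shows "recursive_atom_ordering componentwise_le (boij_soederberg_poset dl du)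
           (sorted_list_of_set (atoms_of (boij_soederberg_poset dl du) componentwise_le))"
  using assms
  by (intro recursive_atom_ordering_boij_soederberg)
    (auto simp: boij_soederberg_bounds_def componentwise_le_iff_nth)

end
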